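(* Fix a time $k$, a measured state $x_k\in\mathbb{R}^{n_x}$ and a horizon $N\ge 1$. Consider the distributionally robust problem $$ \begin{array}{cl} \displaystyle\min_{\mathbf{z},\mathbf{v},\mathbf{K}} & \sum_{i=0}^{N-1}\left(\|z_{i\mid k}\|_{Q}^{2}+\|v_{i\mid k}\|_{R}^{2}\right)+\|z_{N\mid k}\|_{Q_f}^{2}\\ \text{s.t.} & z_{0\mid k}=x_k,\\ & z_{i+1\mid k}=f_d(z_{i\mid k},v_{i\mid k}),\quad v_{i\mid k}=K_{i\mid k}z_{i\mid k}+c_{i\mid k},\quad i=0,\dots,N-1,\\ & \displaystyle\sup_{\mathbb{P}_0,\dots,\mathbb{P}_{i-1}\in\mathcal{P}}\mathbb{E}_{\mathbb{P}_0\times\cdots\times\mathbb{P}_{i-1}}\Big\{[F]_n\Big(z_{i\mid k}+\sum_{m=0}^{i-1}A_{cl}^{(i,m)}W_{m\mid k}\Big)\Big\}\le [f]_n,\quad i=1,\dots,N,\ n=1,\dots,n_F, \end{array} \tag{P} $$ where, in the constraint for index $i$, $(W_{0\mid k},\dots,W_{i-1\mid k})$ has law $\mathbb{P}_0\times\cdots\times\mathbb{P}_{i-1}$. Consider also the problem $$ \begin{array}{cl} \displaystyle\min & \sum_{i=0}^{N-1}\left(\|z_{i\mid k}\|_{Q}^{2}+\|v_{i\mid k}\|_{R}^{2}\right)+\|z_{N\mid k}\|_{Q_f}^{2}\\ \text{s.t.} & z_{0\mid k}=x_k,\\ & z_{i+1\mid k}=f_d(z_{i\mid k},v_{i\mid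 k}),\quad v_{i\mid k}=K_{i\mid k}z_{i\mid k}+c_{i\mid k},\quad i=0,\dots,N-1,\\ & \text{and for all } i\in\{1,\dots,N\},\ n\in\{1,\dots,n_F\}:\\ & \displaystyle\sum_{m=0}^{i-1}\Big(\lambda_m^{i,n}\varepsilon+\frac1M\sum_{l=1}^{M}s_{ml}^{i,n}\Big)\le [f]_n-[F]_n z_{i\mid k},\\ & [F]_nA_{cl}^{(i,m)}\hat w^{(l)}+(\gamma_{ml}^{i,n})^{\top}(h_w-H_w\hat w^{(l)})\le s_{ml}^{i,n},\quad l=1,\dots,M,\ m=0,\dots,i-1,\\ & \big\|H_w^{\top}\gamma_{ml}^{i,n}-\big[[F]_nA_{cl}^{(i,m)}\big]^{\top}\big\|_{*}\le\lambda_m^{i,n},\quad l=1,\dots,M,\ m=0,\dots,i-1,\\ & \gamma_{ml}^{i,n}\ge 0,\quad l=1,\dots,M,\ m=0,\dots,i-1, \end{array} \tag{P'} $$ where the minimization is over $\mathbf{z},\mathbf{v},\mathbf{K}$ and the auxiliary variables $\lambda_m^{i,n}\in\mathbb{R}$, $s_{ml}^{i,n}\in\mathbb{R}$, $\gamma_{ml}^{i,n}\in\mathbb{R}^{n_H}$. Then (P') is an exact reformulation of (P): $(\mathbf{z},\mathbf{v},\mathbf{K})$ is feasible for (P) if and only if there exist values of the auxiliary variables which together with $(\mathbf{z},\mathbf{v},\mathbf{K})$ are feasible for (P'). Since the objectives coincide, the two problems have the same optimal value.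
   Context: Dynamics: $f_d:\mathbb{R}^{n_x}\times\mathbb{R}^{n_u}\to\mathbb{R}^{n_x}$ is a (differentiable) nonlinear map. Decision variables: $\mathbf{z}=(z_{0\mid k},\dots,z_{N\mid k})$ with $z_{i\mid k}\in\mathbb{R}^{n_x}$; $\mathbf{v}=(v_{0\mid k},\dots,v_{N-1\mid k})$ with $v_{i\mid k}\in\mathbb{R}^{n_u}$; $\mathbf{K}=(K_{0\mid k},\dots,K_{N-1\mid k})$ with $K_{i\mid k}\in\mathbb{R}^{n_u\times n_x}$; and $c_{i\mid k}\in\mathbb{R}^{n_u}$ is the offset determined by $v_{i\mid k}=K_{i\mid k}z_{i\mid k}+c_{i\mid k}$. The matrices $Q,Q_f\in\mathbb{R}^{n_x\times n_x}$, $R\in\mathbb{R}^{n_u\times n_u}$ are positive definite and $\|x\|_Q^2=x^\top Qx$. $F\in\mathbb{R}^{n_F\times n_x}$, $f\in\mathbb{R}^{n_F}$; $[F]_n$ is the $n$-th row of $F$ and $[f]_n$ the $n$-th entry of $f$. Closed-loop matrices (depending on $\mathbf z,\mathbf v,\mathbf K$): $A_{i\mid k}=\frac{\partial f_d}{\partial x}(z_{i\mid k},v_{i\mid k})$, $B_{i\mid k}=\frac{\partial f_d}{\partial u}(z_{i\mid k},v_{i\mid k})$, $A_{cl,i}=A_{i\mid k}+B_{i\mid k}K_{i\mid k}$. For $0\le m\le i-1$, $$A_{cl}^{(i,m)}:=\prod_{j=0}^{i-1-m}A_{cl,i-1-j}^{\min\{1,\,i-1-m-j\}}=A_{cl,i-1}A_{cl,i-2}\cdots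 A_{cl,m+1},$$ with $A_{cl}^{(i,i-1)}=I$. Ambiguity set: $\mathbb{W}_w=\{w\in\mathbb{R}^{n_x}\mid H_ww\le h_w\}$ is a polytopic uncertainty set, with $H_w\in\mathbb{R}^{n_H\times n_x}$, $h_w\in\mathbb{R}^{n_H}$. $\hat w^{(1)},\dots,\hat w^{(M)}\in\mathbb{W}_w$ are given samples and $\hat{\mathbb{P}}=\frac1M\sum_{l=1}^M\delta_{\hat w^{(l)}}$. $\mathcal{M}(\mathbb{W}_w)$ is the set of Borel probability measures supported on $\mathbb{W}_w$ with finite first moment. For a fixed norm $\|\cdot\|$ on $\mathbb{R}^{n_x}$ with dual norm $\|\cdot\|_*$, the type-1 Wasserstein metric is $d_w(\mathbb{Q}_1,\mathbb{Q}_2)=\inf_\Pi\int\|\xi_1-\xi_2\|\,\Pi(d\xi_1,d\xi_2)$, the infimum being over couplings $\Pi$ of $\mathbb{Q}_1,\mathbb{Q}_2$. For a radius $\varepsilon>0$, $\mathcal{P}=\{\mathbb{Q}\in\mathcal{M}(\mathbb{W}_w): d_w(\hat{\mathbb{P}},\mathbb{Q})\le\varepsilon\}$. *)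

theory Defs
  imports "HOL-Probability.Probability"
begin

(* Nonnegativity follows from homogeneity and the triangle inequality. *)
definition is_norm :: "('a::real_vector \<Rightarrow> real) \<Rightarrow> bool" where
  "is_norm nrm \<longleftrightarrow>
     (\<forall>x. nrm x = 0 \<longleftrightarrow> x = 0) \<and>
     (\<forall>c x. nrm (c *\<^sub>R x) = \<bar>c\<bar> * nrm x) \<and>
     (\<forall>x y. nrm (x + y) \<le> nrm x + nrm y)"

(* The supremum is finite for every norm on a finite-dimensional space. *)
definition dual_norm :: "('a::euclidean_space \<Rightarrow> real) \<Rightarrow> 'a \<Rightarrow> real" where
  "dual_norm nrm y = (SUP x\<in>{x. nrm x \<le> 1}. y \<bullet> x)"

(* Symmetry is not required, so symmetric positive definite matrices are a special case. *)
definition positive_definite :: "real^'n^'n \<Rightarrow> bool" where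
  "positive_definite A \<longleftrightarrow> (\<forall>x. x \<noteq> 0 \<longrightarrow> x \<bullet> (A *v x) > 0)"

definition quad_form :: "real^'n^'n \<Rightarrow> real^'n \<Rightarrow> real" where
  "quad_form A x = x \<bullet> (A *v x)"

definition polyhedral_set :: "real^'x^'h \<Rightarrow> real^'h \<Rightarrow> (real^'x) set" where
  "polyhedral_set H h = {w. H *v w \<le> h}"

(* Pushforward of the uniform distribution on the indices: repeated samples keep
   their multiplicity, as in the average of the Dirac measures. *)
definition empirical :: "nat \<Rightarrow> (nat \<Rightarrow> 'a::topological_space) \<Rightarrow> 'a measure" where
  "empirical M what = distr (uniform_count_measure {1..M}) borel what"

definition prob_measures_on ::
  "('a::euclidean_space \<Rightarrow> real) \<Rightarrow> 'a set \<Rightarrow> 'a measure set" where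
  "prob_measures_on nrm W =
     {D. prob_space D \<and> sets D = sets borel \<and> emeasure D W = 1 \<and> integrable D nrm}"

definition couplings ::
  "'a::euclidean_space measure \<Rightarrow> 'a measure \<Rightarrow> ('a \<times> 'a) measure set" where
  "couplings D1 D2 =
     {C. prob_space C \<and> sets C = sets (borel \<Otimes>\<^sub>M borel) \<and>
         distr C borel fst = D1 \<and> distr C borel snd = D2}"

definition wasserstein ::
  "('a::euclidean_space \<Rightarrow> real) \<Rightarrow> 'a measure \<Rightarrow> 'a measure \<Rightarrow> ennreal" where
  "wasserstein nrm D1 D2 =
     (INF C\<in>couplings D1 D2. \<integral>\<^sup>+(\<xi>1, \<xi>2). ennreal (nrm (\<xi>1 - \<xi>2)) \<partial>C)"

definition ambiguity_set ::
  "(real^'x \<Rightarrow> real) \<Rightarrow> real^'x^'h \<Rightarrow> real^'h \<Rightarrow> real \<Rightarrow> nat \<Rightarrow> (nat \<Rightarrow> real^'x)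
    \<Rightarrow> (real^'x) measure set" where
  "ambiguity_set nrm H h eps M what =
     {D \<in> prob_measures_on nrm (polyhedral_set H h).
        wasserstein nrm (empirical M what) D \<le> ennreal eps}"

definition A_cl ::
  "((real^'x) \<times> (real^'u) \<Rightarrow> real^'x) \<Rightarrow> (nat \<Rightarrow> real^'x) \<Rightarrow> (nat \<Rightarrow> real^'u)
    \<Rightarrow> (nat \<Rightarrow> real^'x^'u) \<Rightarrow> nat \<Rightarrow> real^'x^'x" where
  "A_cl fd z v K i =
     jacobian (\<lambda>x. fd (x, v i)) (at (z i)) +
     jacobian (\<lambda>u. fd (z i, u)) (at (v i)) ** K i"

(* The ordered product A_cl (i-1) ** A_cl (i-2) ** ... ** A_cl (m+1). *)
definition A_cl_prod ::
  "((real^'x) \<times> (real^'u) \<Rightarrow> real^'x) \<Rightarrow> (nat \<Rightarrow> real^'x) \<Rightarrow> (nat \<Rightarrow> real^'u)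
    \<Rightarrow> (nat \<Rightarrow> real^'x^'u) \<Rightarrow> nat \<Rightarrow> nat \<Rightarrow> real^'x^'x" where
  "A_cl_prod fd z v K i m = foldr (**) (map (A_cl fd z v K) (rev [m+1..<i])) (mat 1)"

lemma A_cl_prod_self: "A_cl_prod fd z v K (Suc m) m = mat 1"
  by (simp add: A_cl_prod_def)

lemma A_cl_prod_Suc:
  "m < i \<Longrightarrow> A_cl_prod fd z v K (Suc i) m = A_cl fd z v K i ** A_cl_prod fd z v K i m"
  by (simp add: A_cl_prod_def)

(* Trajectories and policies are functions on nat; every definition below reads
   z only on {0..N} and v, K only on {0..<N}. *)

definition cost ::
  "real^'x^'x \<Rightarrow> real^'u^'u \<Rightarrow> real^'x^'x \<Rightarrow> nat
    \<Rightarrow> (nat \<Rightarrow> real^'x) \<Rightarrow> (nat \<Rightarrow> real^'u) \<Rightarrow> real" where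
  "cost Q R Qf N z v =
     (\<Sum>i<N. quad_form Q (z i) + quad_form R (v i)) + quad_form Qf (z N)"

(* The offset c is determined by z, v, K, hence quantified here rather than being
   a decision variable. *)
definition nominal_constraints ::
  "((real^'x) \<times> (real^'u) \<Rightarrow> real^'x) \<Rightarrow> nat \<Rightarrow> real^'x
    \<Rightarrow> (nat \<Rightarrow> real^'x) \<Rightarrow> (nat \<Rightarrow> real^'u) \<Rightarrow> (nat \<Rightarrow> real^'x^'u) \<Rightarrow> bool" where
  "nominal_constraints fd N xk z v K \<longleftrightarrow>
     z 0 = xk \<and>
     (\<forall>i<N. z (Suc i) = fd (z i, v i)) \<and>
     (\<exists>c. \<forall>i<N. v i = K i *v z i + c i)"

(* The supremum is taken in ereal, so it is meaningful without a boundedness proof. *)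
definition feasible_P ::
  "((real^'x) \<times> (real^'u) \<Rightarrow> real^'x) \<Rightarrow> real^'x^'f \<Rightarrow> real^'f \<Rightarrow> (real^'x) measure set
    \<Rightarrow> nat \<Rightarrow> real^'x \<Rightarrow> (nat \<Rightarrow> real^'x) \<Rightarrow> (nat \<Rightarrow> real^'u) \<Rightarrow> (nat \<Rightarrow> real^'x^'u) \<Rightarrow> bool" where
  "feasible_P fd F f Amb N xk z v K \<longleftrightarrow>
     nominal_constraints fd N xk z v K \<and>
     (\<forall>i\<in>{1..N}. \<forall>n.
        (SUP P\<in>{..<i} \<rightarrow>\<^sub>E Amb.
           ereal (\<integral>W. row n F \<bullet> (z i + (\<Sum>m<i. A_cl_prod fd z v K i m *v W m))
                    \<partial>(PiM {..<i} P)))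
        \<le> ereal (f $ n))"

definition feasible_P' ::
  "((real^'x) \<times> (real^'u) \<Rightarrow> real^'x) \<Rightarrow> real^'x^'f \<Rightarrow> real^'f
    \<Rightarrow> (real^'x \<Rightarrow> real) \<Rightarrow> real^'x^'h \<Rightarrow> real^'h \<Rightarrow> real \<Rightarrow> nat \<Rightarrow> (nat \<Rightarrow> real^'x)
    \<Rightarrow> nat \<Rightarrow> real^'x \<Rightarrow> (nat \<Rightarrow> real^'x) \<Rightarrow> (nat \<Rightarrow> real^'u) \<Rightarrow> (nat \<Rightarrow> real^'x^'u)
    \<Rightarrow> (nat \<Rightarrow> 'f \<Rightarrow> nat \<Rightarrow> real) \<Rightarrow> (nat \<Rightarrow> 'f \<Rightarrow> nat \<Rightarrow> nat \<Rightarrow> real)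
    \<Rightarrow> (nat \<Rightarrow> 'f \<Rightarrow> nat \<Rightarrow> nat \<Rightarrow> real^'h) \<Rightarrow> bool" where
  "feasible_P' fd F f nrm H h eps M what N xk z v K lam s gam \<longleftrightarrow>
     nominal_constraints fd N xk z v K \<and>
     (\<forall>i\<in>{1..N}. \<forall>n.
        (\<Sum>m<i. lam i n m * eps + 1 / real M * (\<Sum>l=1..M. s i n m l)) \<le> f $ n - row n F \<bullet> z i \<and>
        (\<forall>m<i. \<forall>l\<in>{1..M}.
           (row n F v* A_cl_prod fd z v K i m) \<bullet> what l + gam i n m l \<bullet> (h - H *v what l)
             \<le> s i n m l \<and>
           dual_norm nrm (transpose H *v gam i n m l - row n F v* A_cl_prod fd z v K i m)
             \<le> lam i n m \<and>
           0 \<le> gam i n m l))"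

end

theory Submission
  imports Defs
begin

text \<open>
  The two problems differ only in how the robust constraint for a time \<open>i\<close> and a row \<open>n\<close> is
  written. The integrand in that constraint is affine in the disturbances, with coefficient vectors
  \<open>a m = row n F v* A_cl_prod fd z v K i m\<close>, so its expectation under a product measure is a constant
  plus the sum of the expectations of \<open>a m \<bullet> w\<close> under the factors. The factors range
  independently over the ambiguity set, hence the supremum is the sum of the suprema for the single
  disturbances, and it suffices to prove duality for one linear functional over one Wasserstein ball
  (\<open>robust_constraint_iff\<close>).

  A certificate \<open>(L, s, g)\<close> bounds the worst case: for \<open>w\<close> in the polyhedron it gives
  \<open>a \<bullet> w \<le> s l + L * nrm (what l - w)\<close>, and integrating this against nearly optimal couplings bounds
  the expectation by the mean of the \<open>s l\<close> plus \<open>L * eps\<close> (\<open>worst_case_expectation_le_dual\<close>).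

  Conversely, a certificate is found in finite dimension. The objective is linear and the
  transport cost convex, so the worst case \<open>p\<close> is determined by the measures that move each sample
  as a whole to one other point of the polyhedron. The transport budget has a Lagrange multiplier \<open>L\<close>,
  because leaving all samples in place uses none of the budget \<open>eps > 0\<close>
  (\<open>scalar_Lagrange_multiplier\<close>). With the budget priced, the samples decouple, and for each of them
  the maximum of a linear functional penalised by \<open>L\<close> times the norm over a polyhedron has an
  attained dual solution (\<open>norm_penalised_polyhedral_duality\<close>), since finitely generated cones are
  closed. Attainment matters: it makes the feasible sets coincide exactly, and not only up to
  closure. Equality of the optimal values then follows because the objectives agree.
\<close>

section \<open>Norms on a Euclidean space and their duals\<close>

lemma is_norm_zero: "is_norm nrm \<Longrightarrow> nrm 0 = 0"
  by (simp add: is_norm_def)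

lemma is_norm_scaleR: "is_norm nrm \<Longrightarrow> nrm (c *\<^sub>R x) = \<bar>c\<bar> * nrm x"
  by (simp add: is_norm_def)

lemma is_norm_triangle: "is_norm nrm \<Longrightarrow> nrm (x + y) \<le> nrm x + nrm y"
  by (simp add: is_norm_def)

lemma is_norm_minus: "is_norm nrm \<Longrightarrow> nrm (- x) = nrm x"
  using is_norm_scaleR[of nrm "-1" x] by simp

lemma is_norm_nonneg:
  assumes "is_norm nrm"
  shows "nrm x \<ge> 0"
  using is_norm_triangle[OF assms, of x "- x"] assms
  by (simp add: is_norm_zero is_norm_minus)

lemma is_norm_convex_on:
  assumes "is_norm nrm"
  shows "convex_on UNIV nrm"
proof (rule convex_onI)
  fix t :: real and x y assume "0 < t" "t < 1"
  then show "nrm ((1 - t) *\<^sub>R x + t *\<^sub>R y) \<le> (1 - t) * nrm x + t * nrm y"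
    using is_norm_triangle[OF assms, of "(1 - t) *\<^sub>R x" "t *\<^sub>R y"]
    by (simp add: is_norm_scaleR[OF assms])
qed simp

lemma is_norm_continuous_on:
  fixes nrm :: "'a::euclidean_space \<Rightarrow> real"
  assumes "is_norm nrm"
  shows "continuous_on A nrm"
  using convex_on_continuous[OF open_UNIV is_norm_convex_on[OF assms]] continuous_on_subset by blast

text \<open>Compactness of the Euclidean unit sphere gives the two constants. The lower one makes linear
  functionals integrable against every measure with finite first moment, the upper one makes
  dual balls bounded.\<close>

lemma is_norm_equivalent:
  fixes nrm :: "'a::euclidean_space \<Rightarrow> real"
  assumes "is_norm nrm"
  obtains c C where "c > 0" "C > 0" "\<And>x. c * norm x \<le> nrm x" "\<And>x. nrm x \<le> C * norm x"
proof -
  have ne: "sphere (0::'a) 1 \<noteq> {}" by simp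
  obtain u where u: "u \<in> sphere 0 1" "\<And>x. x \<in> sphere 0 1 \<Longrightarrow> nrm u \<le> nrm x"
    using continuous_attains_inf[OF compact_sphere ne is_norm_continuous_on[OF assms]] by blast
  obtain v where v: "v \<in> sphere 0 1" "\<And>x. x \<in> sphere 0 1 \<Longrightarrow> nrm x \<le> nrm v"
    using continuous_attains_sup[OF compact_sphere ne is_norm_continuous_on[OF assms]] by blast
  have "u \<noteq> 0" using u(1) by auto
  then have pos: "nrm u > 0"
    using assms is_norm_nonneg[OF assms, of u] by (simp add: is_norm_def less_le)
  have scale: "nrm x = norm x * nrm (x /\<^sub>R norm x)" if "x \<noteq> 0" for x
    using that by (simp add: is_norm_scaleR[OF assms])
  have unit: "x /\<^sub>R norm x \<in> sphere 0 1" if "x \<noteq> 0" for x :: 'a using that by simp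
  have lower: "nrm u * norm x \<le> nrm x" for x
  proof (cases "x = 0")
    case False
    then show ?thesis
      using u(2)[OF unit[OF False]] scale[OF False] mult_left_mono[of "nrm u" _ "norm x"]
      by (metis mult.commute norm_ge_zero)
  qed (simp add: is_norm_zero[OF assms])
  have upper: "nrm x \<le> nrm v * norm x" for x
  proof (cases "x = 0")
    case False
    then show ?thesis
      using v(2)[OF unit[OF False]] scale[OF False] mult_left_mono[of _ "nrm v" "norm x"]
      by (metis mult.commute norm_ge_zero)
  qed (simp add: is_norm_zero[OF assms])
  have "nrm v > 0" using pos u(1) v(2)[of u] by linarith
  with that pos lower upper show thesis by blast
qed

text \<open>Replaces the supremum over the unit ball by a homogeneous inequality, the form in which every
  dual norm constraint is used below. Since \<open>0\<close> lies in the unit ball, such a bound also forces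
  the multiplier \<open>L\<close> to be nonnegative.\<close>

lemma dual_norm_le_iff:
  fixes nrm :: "'a::euclidean_space \<Rightarrow> real"
  assumes "is_norm nrm"
  shows "dual_norm nrm y \<le> L \<longleftrightarrow> 0 \<le> L \<and> (\<forall>x. y \<bullet> x \<le> L * nrm x)"
proof
  obtain c C where c: "c > 0" "\<And>x. c * norm x \<le> nrm x"
    using is_norm_equivalent[OF assms] by metis
  have bdd: "bdd_above ((\<lambda>x. y \<bullet> x) ` {x. nrm x \<le> 1})"
  proof (rule bdd_aboveI2)
    fix x assume "x \<in> {x. nrm x \<le> 1}"
    then have "norm x \<le> 1 / c" using c(2)[of x] c(1) by (simp add: field_simps)
    then show "y \<bullet> x \<le> norm y * (1 / c)"
      using norm_cauchy_schwarz[of y x] mult_left_mono[of "norm x" "1 / c" "norm y"] by simp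
  qed
  assume le: "dual_norm nrm y \<le> L"
  have unit: "y \<bullet> x \<le> L" if "nrm x \<le> 1" for x
    using cSUP_upper[OF _ bdd, of x] that le by (simp add: dual_norm_def)
  have "0 \<le> L" using unit[of 0] by (simp add: is_norm_zero[OF assms])
  moreover have "y \<bullet> x \<le> L * nrm x" for x
  proof (cases "x = 0")
    case False
    then have "nrm x > 0" using c(1) c(2)[of x] by (smt (verit) mult_pos_pos zero_less_norm_iff)
    then show ?thesis
      using unit[of "x /\<^sub>R nrm x"] by (simp add: is_norm_scaleR[OF assms] field_simps)
  qed (simp add: is_norm_zero[OF assms])
  ultimately show "0 \<le> L \<and> (\<forall>x. y \<bullet> x \<le> L * nrm x)" by blast
next
  assume *: "0 \<le> L \<and> (\<forall>x. y \<bullet> x \<le> L * nrm x)"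
  show "dual_norm nrm y \<le> L"
    unfolding dual_norm_def
  proof (rule cSUP_least)
    have "0 \<in> {x. nrm x \<le> 1}" by (simp add: is_norm_zero[OF assms])
    then show "{x. nrm x \<le> 1} \<noteq> {}" by blast
    fix x assume "x \<in> {x. nrm x \<le> 1}"
    then show "y \<bullet> x \<le> L" using * mult_left_le[of "nrm x" L] by (smt (verit) mem_Collect_eq)
  qed
qed

text \<open>The Hahn-Banach theorem in finite dimension: a norm is the supremum of the linear functionals it
  dominates. The functional comes from separating a point slightly outside the closed unit ball
  from that ball. This is what makes the norm dual to the dual norm.\<close>

lemma norming_functional:
  fixes nrm :: "'a::euclidean_space \<Rightarrow> real"
  assumes nrm: "is_norm nrm" and less: "r < nrm x"
  obtains y where "\<And>w. y \<bullet> w \<le> nrm w" "r < y \<bullet> x"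
proof (cases "r < 0")
  case True
  then show ?thesis using that[of 0] is_norm_nonneg[OF nrm] by simp
next
  case False
  define B where "B = {w. nrm w \<le> 1}"
  have pos: "nrm x > 0" using False less by linarith
  \<comment> \<open>Dividing by a number strictly between \<open>r\<close> and \<open>nrm x\<close> puts \<open>x\<close> strictly outside the unit ball.\<close>
  define q where "q = (r + nrm x) / 2"
  have q: "0 < q" "r < q" "q < nrm x" using False less pos by (auto simp: q_def)
  have "closed B"
    unfolding B_def by (intro closed_Collect_le is_norm_continuous_on[OF nrm] continuous_on_const)
  moreover have "convex B"
    unfolding B_def
  proof (rule convexI, unfold mem_Collect_eq)
    fix w w' and u v :: real assume "nrm w \<le> 1" "nrm w' \<le> 1" "0 \<le> u" "0 \<le> v" "u + v = 1"
    then show "nrm (u *\<^sub>R w + v *\<^sub>R w') \<le> 1"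
      using is_norm_triangle[OF nrm, of "u *\<^sub>R w" "v *\<^sub>R w'"]
        mult_left_mono[of "nrm w" 1 u] mult_left_mono[of "nrm w'" 1 v]
      by (simp add: is_norm_scaleR[OF nrm])
  qed
  moreover have "x /\<^sub>R q \<notin> B"
    using q by (simp add: B_def is_norm_scaleR[OF nrm] field_simps)
  ultimately have "\<exists>a b. a \<bullet> (x /\<^sub>R q) < b \<and> (\<forall>w\<in>B. a \<bullet> w > b)"
    by (intro separating_hyperplane_closed_point)
  then obtain a b where ab: "a \<bullet> (x /\<^sub>R q) < b" "\<And>w. w \<in> B \<Longrightarrow> a \<bullet> w > b"
    by blast
  have b: "b < 0" using ab(2)[of 0] by (simp add: B_def is_norm_zero[OF nrm])
  define y where "y = a /\<^sub>R b"
  have yB: "y \<bullet> w \<le> 1" if "nrm w \<le> 1" for w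
    using ab(2)[of w] that b by (simp add: B_def y_def field_simps)
  have "y \<bullet> w \<le> nrm w" for w
  proof -
    have "dual_norm nrm y \<le> 1"
      unfolding dual_norm_def
    proof (rule cSUP_least)
      have "0 \<in> {x. nrm x \<le> 1}" by (simp add: is_norm_zero[OF nrm])
      then show "{x. nrm x \<le> 1} \<noteq> {}" by blast
    qed (simp add: yB)
    then show ?thesis using dual_norm_le_iff[OF nrm] by fastforce
  qed
  moreover have "q < y \<bullet> x"
    using ab(1) b q by (simp add: y_def field_simps)
  ultimately show ?thesis using that q by fastforce
qed

section \<open>Duality for a linear functional penalised by a norm over a polyhedron\<close>

lemma convex_cone_hull_sum:
  assumes "\<And>i. i \<in> I \<Longrightarrow> f i \<in> convex_cone hull T"
  shows "sum f I \<in> convex_cone hull T"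
  using assms
  by (induction I rule: infinite_finite_induct)
    (simp_all add: convex_cone_hull_contains_0 convex_cone_hull_add)

text \<open>The pairs consisting of a vector \<open>H\<^sup>T g\<close> and an upper bound for its price \<open>g \<bullet> b\<close> form a
  finitely generated cone, hence a closed one. The multipliers \<open>g\<close> themselves may be unbounded
  (constraints active at a sample cost nothing), so it is this closedness, and not
  compactness, that makes the dual optimum attained.\<close>

lemma closed_convex_cone_of_constraints:
  fixes H :: "real^'x^'h" and b :: "real^'h"
  defines "K \<equiv> {(transpose H *v g, g \<bullet> b + r) |g r. 0 \<le> g \<and> 0 \<le> (r::real)}"
  shows "closed K" "convex K"
proof -
  define T where "T = insert (0, 1) (range (\<lambda>i. (row i H, b $ i)))"
  have K_memI: "(transpose H *v g, g \<bullet> b + r) \<in> K" if "0 \<le> g" "0 \<le> r" for g r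
    using that unfolding K_def by blast
  have axis_nonneg: "0 \<le> (axis i 1 :: real^'h)" for i
    by (simp add: less_eq_vec_def axis_def)
  have "K = convex_cone hull T"
  proof
    show "K \<subseteq> convex_cone hull T"
    proof
      fix q assume "q \<in> K"
      then obtain g r where g: "0 \<le> g" "0 \<le> r" "q = (transpose H *v g, g \<bullet> b + r)"
        by (auto simp: K_def)
      have "(\<Sum>i\<in>UNIV. g $ i *\<^sub>R (row i H, b $ i)) \<in> convex_cone hull T"
        using g(1)
        by (intro convex_cone_hull_sum convex_cone_hull_mul hull_inc)
          (simp_all add: T_def less_eq_vec_def)
      moreover have "r *\<^sub>R (0, 1) \<in> convex_cone hull T"
        using g(2) by (intro convex_cone_hull_mul hull_inc) (simp_all add: T_def)
      moreover have "q = (\<Sum>i\<in>UNIV. g $ i *\<^sub>R (row i H, b $ i)) + r *\<^sub>R (0, 1)"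
        by (simp add: g(3) prod_eq_iff fst_sum snd_sum inner_vec_def vec_eq_iff
            matrix_vector_mult_def transpose_def row_def mult.commute del: transpose_matrix_vector)
      ultimately show "q \<in> convex_cone hull T"
        by (simp only: convex_cone_hull_add)
    qed
    have "convex_cone K"
      unfolding convex_cone_iff
    proof (intro conjI ballI allI impI)
      show "0 \<in> K"
        using K_memI[of 0 0] by (simp add: zero_prod_def)
      fix p assume "p \<in> K"
      then obtain g r where p: "0 \<le> g" "0 \<le> r" "p = (transpose H *v g, g \<bullet> b + r)"
        by (auto simp: K_def)
      {
        fix q assume "q \<in> K"
        then obtain g' r' where q: "0 \<le> g'" "0 \<le> r'" "q = (transpose H *v g', g' \<bullet> b + r')"
          by (auto simp: K_def)
        have "p + q = (transpose H *v (g + g'), (g + g') \<bullet> b + (r + r'))"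
          by (simp add: p(3) q(3) algebra_simps)
        then show "p + q \<in> K"
          using K_memI[of "g + g'" "r + r'"] p(1,2) q(1,2) by simp
      }
      fix c :: real assume "0 \<le> c"
      moreover have "c *\<^sub>R p = (transpose H *v (c *\<^sub>R g), (c *\<^sub>R g) \<bullet> b + c * r)"
        by (simp add: p(3) matrix_vector_mult_scaleR algebra_simps del: transpose_matrix_vector)
      ultimately show "c *\<^sub>R p \<in> K"
        using K_memI[of "c *\<^sub>R g" "c * r"] p(1,2) by (simp add: less_eq_vec_def)
    qed
    moreover have "T \<subseteq> K"
    proof -
      have "(0, 1) \<in> K"
        using K_memI[of 0 1] by simp
      moreover have "(row i H, b $ i) \<in> K" for i
        using K_memI[OF axis_nonneg order_refl, of i]
        by (simp add: inner_axis' matrix_vector_mult_basis column_def row_def transpose_def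
            del: transpose_matrix_vector)
      ultimately show ?thesis by (auto simp: T_def)
    qed
    ultimately show "convex_cone hull T \<subseteq> K" by (simp add: hull_minimal)
  qed
  then show "closed K" "convex K"
    by (simp_all add: closed_convex_cone_hull convex_convex_cone_hull T_def)
qed

text \<open>A Farkas lemma with a norm penalty. The wanted \<open>g\<close> exists iff \<open>(a, \<sigma>)\<close> lies in the sum of the
  cone of constraint prices and the dual ball of radius \<open>L\<close>, taken at height \<open>0\<close>. The sum is closed
  and convex, so if the point were outside, a hyperplane would separate it. Its normal \<open>(x, - t)\<close>
  satisfies \<open>H x \<le> t b\<close>, because the cone lies on one side, and \<open>L nrm x < a \<bullet> x - t \<sigma>\<close>, because
  the dual ball does. For \<open>t > 0\<close> the point \<open>x / t\<close> then violates the assumed bound. For \<open>t = 0\<close> the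
  vector \<open>x\<close> is a recession direction of the polyhedron along which the penalised functional grows
  without bound; \<open>0 \<le> b\<close> ensures that its multiples are feasible.\<close>

lemma norm_penalised_polyhedral_duality:
  fixes H :: "real^'x^'h" and a :: "real^'x" and b :: "real^'h"
  assumes nrm: "is_norm nrm" and b: "0 \<le> b" and L: "0 \<le> L"
    and bound: "\<And>x. H *v x \<le> b \<Longrightarrow> a \<bullet> x - L * nrm x \<le> \<sigma>"
  obtains g where "0 \<le> g" "g \<bullet> b \<le> \<sigma>" "dual_norm nrm (transpose H *v g - a) \<le> L"
proof -
  define K where "K = {(transpose H *v g, g \<bullet> b + r) |g r. 0 \<le> g \<and> 0 \<le> (r::real)}"
  define D where "D = {y. \<forall>w. y \<bullet> w \<le> L * nrm w}"
  define S where "S = (\<Union>p\<in>K. \<Union>d\<in>D \<times> {0}. {p + d})"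
  obtain c C where C: "C > 0" "\<And>x. nrm x \<le> C * norm x"
    using is_norm_equivalent[OF nrm] by metis
  have "closed D"
    unfolding D_def by (intro closed_Collect_all closed_Collect_le continuous_intros)
  moreover have "bounded D"
  proof (rule boundedI)
    fix y assume "y \<in> D"
    then have "norm y * norm y \<le> L * nrm y" by (simp add: D_def power2_norm_eq_inner flip: power2_eq_square)
    also have "\<dots> \<le> L * (C * norm y)" using C L by (simp add: mult_left_mono)
    finally show "norm y \<le> L * C"
      by (cases "y = 0") (use C L in auto)
  qed
  ultimately have "compact D" by (simp add: compact_eq_bounded_closed)
  have convD: "convex D"
  proof -
    have "D = (\<Inter>w. {y. y \<bullet> w \<le> L * nrm w})" by (auto simp: D_def)
    moreover have "convex {y. y \<bullet> w \<le> L * nrm w}" for w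
      using convex_halfspace_le[of w] by (simp add: inner_commute)
    ultimately show ?thesis by (simp add: convex_INT)
  qed
  have "closed S"
    unfolding S_def K_def
    by (intro closed_compact_sums closed_convex_cone_of_constraints compact_Times \<open>compact D\<close>) simp
  moreover have "convex S"
    unfolding S_def K_def
    by (intro convex_sums closed_convex_cone_of_constraints convex_Times convD) simp
  moreover have "(a, \<sigma>) \<in> S"
  proof (rule ccontr)
    assume "(a, \<sigma>) \<notin> S"
    with separating_hyperplane_closed_point[OF \<open>convex S\<close> \<open>closed S\<close>]
    obtain n \<beta> where sep: "n \<bullet> (a, \<sigma>) < \<beta>" "\<And>q. q \<in> S \<Longrightarrow> n \<bullet> q > \<beta>" by blast
    obtain x0 t where n: "n = (x0, t)" by fastforce
    define x where "x = - x0"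
    have S: "(transpose H *v g + y, g \<bullet> b + r) \<in> S" if "0 \<le> g" "0 \<le> r" "y \<in> D" for g r y
      unfolding S_def K_def using that by fastforce
    have out: "- \<beta> < x \<bullet> a - t * \<sigma>"
      using sep(1) by (simp add: n x_def)
    have sepS: "x \<bullet> (transpose H *v g) + x \<bullet> y - t * (g \<bullet> b) - t * r < - \<beta>"
      if "0 \<le> g" "0 \<le> r" "y \<in> D" for g r y
      using sep(2)[OF S[OF that]]
      by (simp add: n x_def inner_add_right algebra_simps)
    have D0: "0 \<in> D" using L is_norm_nonneg[OF nrm] by (simp add: D_def)
    \<comment> \<open>The generator \<open>(0, 1)\<close> may be scaled arbitrarily, so the price direction has the right sign.\<close>
    have t: "0 \<le> t"
    proof (rule ccontr)
      assume "\<not> 0 \<le> t"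
      then show False
        using sepS[of 0 "\<bar>\<beta>\<bar> / (- t)" 0] D0 by (auto simp: field_simps)
    qed
    \<comment> \<open>Likewise for the generator belonging to the \<open>i\<close>-th constraint.\<close>
    have Hx: "H *v x \<le> t *\<^sub>R b"
      unfolding less_eq_vec_def
    proof (rule allI, rule ccontr)
      fix i assume "\<not> (H *v x) $ i \<le> (t *\<^sub>R b) $ i"
      then have pos: "(H *v x) $ i - t * b $ i > 0" by simp
      define k where "k = \<bar>\<beta>\<bar> / ((H *v x) $ i - t * b $ i)"
      have k: "0 \<le> k" using pos by (simp add: k_def)
      have "0 \<le> k *\<^sub>R (axis i 1 :: real^'h)" using k by (simp add: less_eq_vec_def axis_def)
      from sepS[OF this order_refl D0]
      have "k * ((H *v x) $ i - t * b $ i) < - \<beta>"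
        by (simp add: dot_lmul_matrix[symmetric] inner_commute[of x] matrix_vector_mult_scaleR
            inner_axis' inner_axis transpose_matrix_vector algebra_simps)
          (simp add: dot_lmul_matrix inner_axis' inner_axis algebra_simps)
      then show False using pos by (simp add: k_def)
    qed
    \<comment> \<open>The dual ball contains \<open>L *\<^sub>R y\<close> for functionals \<open>y\<close> whose value at \<open>x\<close> is as close to
      \<open>nrm x\<close> as desired; the strict gap at \<open>- \<beta>\<close> absorbs the error.\<close>
    have above: "L * nrm x < x \<bullet> a - t * \<sigma>"
    proof (rule ccontr)
      assume neg: "\<not> ?thesis"
      show False
      proof (cases "L = 0")
        case True
        then show False using neg out sepS[OF order_refl order_refl D0] by simp
      next
        case False
        then have "L > 0" using L by simp
        then have "- \<beta> / L < nrm x" using neg out by (simp add: field_simps)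
        then obtain y where y: "\<And>w. y \<bullet> w \<le> nrm w" "- \<beta> / L < y \<bullet> x"
          using norming_functional[OF nrm] by blast
        have "L *\<^sub>R y \<in> D" using y(1) L by (simp add: D_def mult_left_mono)
        from sepS[OF order_refl order_refl this] show False
          using y(2) \<open>L > 0\<close> by (simp add: inner_commute field_simps)
      qed
    qed
    show False
    proof (cases "t = 0")
      case True
      define k where "k = (\<bar>\<sigma>\<bar> + 1) / (x \<bullet> a - L * nrm x)"
      have pos: "x \<bullet> a - L * nrm x > 0" using above True by simp
      then have k: "0 < k" by (simp add: k_def)
      have "H *v (k *\<^sub>R x) = k *\<^sub>R (H *v x)" by (simp add: matrix_vector_mult_scaleR)
      also have "\<dots> \<le> k *\<^sub>R 0" using Hx True k by (simp add: less_eq_vec_def mult_le_0_iff)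
      also have "\<dots> \<le> b" using b by simp
      finally have "a \<bullet> (k *\<^sub>R x) - L * nrm (k *\<^sub>R x) \<le> \<sigma>" by (rule bound)
      then have "k * (x \<bullet> a - L * nrm x) \<le> \<sigma>"
        using k by (simp add: is_norm_scaleR[OF nrm] inner_commute algebra_simps)
      then show False using pos by (simp add: k_def)
    next
      case False
      with t have t: "t > 0" by simp
      have "H *v (x /\<^sub>R t) \<le> b"
        using Hx t by (simp add: matrix_vector_mult_scaleR less_eq_vec_def field_simps)
      from bound[OF this] have "a \<bullet> x - L * nrm x \<le> t * \<sigma>"
        using t by (simp add: is_norm_scaleR[OF nrm] field_simps)
      then show False using above by (simp add: inner_commute)
    qed
  qed
  ultimately obtain g y r where g: "0 \<le> g" "0 \<le> r" "y \<in> D" "a = transpose H *v g + y" "\<sigma> = g \<bullet> b + r"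
    unfolding S_def K_def by auto
  have "dual_norm nrm (transpose H *v g - a) \<le> L"
    unfolding dual_norm_le_iff[OF nrm]
  proof (intro conjI allI L)
    fix w
    show "(transpose H *v g - a) \<bullet> w \<le> L * nrm w"
      using g(3)[unfolded D_def] is_norm_minus[OF nrm, of w] by (auto simp: g(4) dest: spec[of _ "- w"])
  qed
  with g that show thesis by fastforce
qed

section \<open>A Lagrange multiplier for the transport budget\<close>

text \<open>Lagrange duality for one scalar constraint. A pair \<open>(t, v)\<close> in \<open>S\<close> stands for a decision that
  achieves value \<open>v\<close> within budget \<open>t\<close>, and \<open>p\<close> bounds all values achievable within budget \<open>e\<close>.
  The multiplier is the slope of a line separating \<open>S\<close> from the vertical ray above \<open>(e, p)\<close>. The line
  is not vertical, because \<open>(t0, v0)\<close> needs strictly less than the budget \<open>e\<close> (Slater's condition),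
  and its slope is nonnegative because unused budget is allowed.\<close>

lemma scalar_Lagrange_multiplier:
  fixes S :: "(real \<times> real) set" and e p :: real
  assumes conv: "convex S"
    and up: "\<And>t v t'. (t, v) \<in> S \<Longrightarrow> t \<le> t' \<Longrightarrow> (t', v) \<in> S"
    and slater: "(t0, v0) \<in> S" "t0 < e"
    and bound: "\<And>v. (e, v) \<in> S \<Longrightarrow> v \<le> p"
  obtains L where "0 \<le> L" "\<And>t v. (t, v) \<in> S \<Longrightarrow> v - L * (t - e) \<le> p"
proof -
  let ?T = "{e} \<times> {p<..}"
  have "convex ?T" by (intro convex_Times) auto
  moreover have "S \<inter> ?T = {}" using bound by force
  moreover have "S \<noteq> {}" "?T \<noteq> {}" using slater(1) gt_ex[of p] by auto
  ultimately obtain n \<beta> where n: "n \<noteq> 0" "\<And>q. q \<in> S \<Longrightarrow> n \<bullet> q \<le> \<beta>" "\<And>q. q \<in> ?T \<Longrightarrow> n \<bullet> q \<ge> \<beta>"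
    using separating_hyperplane_sets[OF conv, of ?T] by metis
  obtain u w where uw: "n = (u, w)" by fastforce
  have S: "u * t + w * v \<le> \<beta>" if "(t, v) \<in> S" for t v
    using n(2)[OF that] by (simp add: uw)
  have T: "\<beta> \<le> u * e + w * v" if "p < v" for v
    using n(3)[of "(e, v)"] that by (simp add: uw)
  \<comment> \<open>The ray is open at \<open>(e, p)\<close>; the bound extends to its endpoint by continuity.\<close>
  have limit: "\<beta> \<le> u * e + w * p"
  proof (rule tendsto_lowerbound)
    show "((\<lambda>v. u * e + w * v) \<longlongrightarrow> u * e + w * p) (at_right p)" by (intro tendsto_intros)
    show "\<forall>\<^sub>F v in at_right p. \<beta> \<le> u * e + w * v"
      using T by (auto simp: eventually_at_right_field intro: gt_ex)
  qed simp
  have u: "u \<le> 0"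
  proof (rule ccontr)
    assume "\<not> u \<le> 0"
    define t where "t = max t0 ((\<bar>\<beta>\<bar> + \<bar>w * v0\<bar> + 1) / u)"
    have "(t, v0) \<in> S" using up[OF slater(1)] by (simp add: t_def)
    moreover have "u * t \<ge> \<bar>\<beta>\<bar> + \<bar>w * v0\<bar> + 1"
      using \<open>\<not> u \<le> 0\<close> mult_left_mono[of "(\<bar>\<beta>\<bar> + \<bar>w * v0\<bar> + 1) / u" t u]
      by (simp add: t_def)
    ultimately show False using S[of t v0] by linarith
  qed
  have ev0: "(e, v0) \<in> S" using up[OF slater(1)] slater(2) by simp
  have w: "0 < w"
  proof (rule ccontr)
    assume "\<not> 0 < w"
    then consider "w < 0" | "w = 0" by linarith
    then show False
    proof cases
      case 1
      then have "w * (max p v0 + 1) < w * v0" by (simp add: mult_less_cancel_left)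
      moreover have "\<beta> \<le> u * e + w * (max p v0 + 1)" by (rule T) linarith
      ultimately show False using S[OF ev0] by linarith
    next
      case 2
      then have "u \<noteq> 0" using n(1) uw by (simp add: zero_prod_def)
      then have "u * e < u * t0" using u slater(2) by (simp add: mult_less_cancel_left)
      then show False using S[OF slater(1)] limit 2 by simp
    qed
  qed
  show thesis
  proof (rule that[of "- u / w"])
    show "0 \<le> - u / w" using u w by (simp add: divide_nonpos_pos)
    fix t v assume "(t, v) \<in> S"
    then have "u * t + w * v \<le> u * e + w * p" using S limit by fastforce
    then have "(w * v + u * (t - e)) / w \<le> p" using w by (simp add: pos_divide_le_eq algebra_simps)
    moreover have "v - - u / w * (t - e) = (w * v + u * (t - e)) / w"
      using w by (simp add: add_divide_distrib)
    ultimately show "v - - u / w * (t - e) \<le> p" by simp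
  qed
qed

text \<open>If a sum of independently chosen numbers is bounded, then the suprema of the single choices
  satisfy the same bound. The bounds \<open>p\<close> stand for the suprema, whose existence is part of the
  claim. The lemma splits the joint constraint over the horizon into one problem for each disturbance, and the penalised transport problem into one for each sample.\<close>

lemma separate_upper_bounds:
  fixes S :: "'i \<Rightarrow> real set"
  assumes "finite I" and "\<And>i. i \<in> I \<Longrightarrow> S i \<noteq> {}"
    and "\<And>x. (\<And>i. i \<in> I \<Longrightarrow> x i \<in> S i) \<Longrightarrow> (\<Sum>i\<in>I. x i) \<le> c"
  obtains p where "\<And>i y. i \<in> I \<Longrightarrow> y \<in> S i \<Longrightarrow> y \<le> p i" "(\<Sum>i\<in>I. p i) \<le> c"
  using assms
proof (induction I arbitrary: c thesis rule: finite_induct)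
  case empty
  from empty.prems(1)[of "\<lambda>_. 0"] empty.prems(3) show ?case by fastforce
next
  case (insert j I)
  define q where "q = Sup (S j)"
  \<comment> \<open>Updating the choice at the new index leaves the sum over the old ones unchanged.\<close>
  have le: "y + (\<Sum>i\<in>I. x i) \<le> c" if "y \<in> S j" "\<And>i. i \<in> I \<Longrightarrow> x i \<in> S i" for x y
  proof -
    have "(\<Sum>i\<in>insert j I. (x(j := y)) i) \<le> c"
      using that by (intro insert.prems(3)) auto
    moreover have "(\<Sum>i\<in>I. (x(j := y)) i) = (\<Sum>i\<in>I. x i)"
      using insert.hyps by (intro sum.cong) auto
    ultimately show ?thesis using insert.hyps by simp
  qed
  have "\<forall>i\<in>I. \<exists>y. y \<in> S i" using insert.prems(2) by blast
  then obtain x0 where "\<And>i. i \<in> I \<Longrightarrow> x0 i \<in> S i" by metis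
  then have bdd: "bdd_above (S j)"
    using le[of _ x0] by (intro bdd_aboveI[of _ "c - (\<Sum>i\<in>I. x0 i)"]) (simp add: algebra_simps)
  have "(\<Sum>i\<in>I. x i) \<le> c - q" if "\<And>i. i \<in> I \<Longrightarrow> x i \<in> S i" for x
  proof -
    have "q \<le> c - (\<Sum>i\<in>I. x i)"
      unfolding q_def using le[OF _ that] insert.prems(2)[of j]
      by (intro cSup_least) (auto simp: algebra_simps)
    then show ?thesis by simp
  qed
  then obtain p where p: "\<And>i y. i \<in> I \<Longrightarrow> y \<in> S i \<Longrightarrow> y \<le> p i" "(\<Sum>i\<in>I. p i) \<le> c - q"
    using insert.IH[of "c - q"] insert.prems(2) by blast
  show ?case
  proof (rule insert.prems(1)[of "p(j := q)"])
    fix i y assume "i \<in> insert j I" "y \<in> S i"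
    then show "y \<le> (p(j := q)) i"
      using p(1) cSup_upper[OF _ bdd] by (auto simp: q_def)
  next
    show "(\<Sum>i\<in>insert j I. (p(j := q)) i) \<le> c"
    proof -
      have "(\<Sum>i\<in>I. (p(j := q)) i) = (\<Sum>i\<in>I. p i)"
        using insert.hyps by (intro sum.cong) auto
      then show ?thesis using insert.hyps p(2) by simp
    qed
  qed
qed

section \<open>Empirical measures and optimal transport\<close>

lemma prob_space_empirical:
  assumes "M \<ge> 1"
  shows "prob_space (empirical M y)"
  unfolding empirical_def
  by (intro prob_space.prob_space_distr prob_space_uniform_count_measure)
    (use assms in auto)

lemma empirical_integral:
  fixes g :: "'a::topological_space \<Rightarrow> real"
  assumes "g \<in> borel_measurable borel"
  shows "integrable (empirical M y) g"
    and "(\<integral>\<xi>. g \<xi> \<partial>empirical M y) = (\<Sum>l=1..M. g (y l)) / real M"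
proof -
  show "integrable (empirical M y) g"
    unfolding empirical_def
    by (subst integrable_distr_eq)
      (auto simp: assms uniform_count_measure_def intro!: integrable_point_measure_finite)
  show "(\<integral>\<xi>. g \<xi> \<partial>empirical M y) = (\<Sum>l=1..M. g (y l)) / real M"
    unfolding empirical_def
    by (subst integral_distr) (auto simp: assms integral_uniform_count_measure)
qed

text \<open>Moving the \<open>l\<close>-th atom of one empirical measure to the \<open>l\<close>-th atom of the other is a coupling,
  namely the image of the uniform distribution on the indices.\<close>

lemma wasserstein_empirical_le:
  assumes nrm: "is_norm nrm" and M: "M \<ge> 1"
  shows "wasserstein nrm (empirical M x) (empirical M y)
           \<le> ennreal ((\<Sum>l=1..M. nrm (x l - y l)) / real M)"
proof -
  let ?U = "uniform_count_measure {1..M}"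
  let ?C = "distr ?U (borel \<Otimes>\<^sub>M borel) (\<lambda>l. (x l, y l))"
  have [measurable]: "nrm \<in> borel_measurable borel"
    by (intro borel_measurable_continuous_onI is_norm_continuous_on[OF nrm])
  have "prob_space ?C"
    by (intro prob_space.prob_space_distr prob_space_uniform_count_measure) (use M in auto)
  then have "?C \<in> couplings (empirical M x) (empirical M y)"
    by (simp add: couplings_def empirical_def distr_distr comp_def)
  then have "wasserstein nrm (empirical M x) (empirical M y)
      \<le> (\<integral>\<^sup>+(\<xi>1, \<xi>2). ennreal (nrm (\<xi>1 - \<xi>2)) \<partial>?C)"
    unfolding wasserstein_def by (rule INF_lower)
  also have "\<dots> = (\<integral>\<^sup>+l. ennreal (nrm (x l - y l)) \<partial>?U)"
    by (subst nn_integral_distr) auto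
  also have "\<dots> = ennreal (\<integral>l. nrm (x l - y l) \<partial>?U)"
    by (rule nn_integral_eq_integral)
      (auto simp: uniform_count_measure_def is_norm_nonneg[OF nrm] intro!: integrable_point_measure_finite)
  also have "\<dots> = ennreal ((\<Sum>l=1..M. nrm (x l - y l)) / real M)"
    by (simp add: integral_uniform_count_measure)
  finally show ?thesis .
qed

lemma closed_polyhedral_set: "closed (polyhedral_set H h)"
proof -
  have "polyhedral_set H h = (\<Inter>i. {w. row i H \<bullet> w \<le> h $ i})"
    by (auto simp: polyhedral_set_def less_eq_vec_def matrix_vector_mul_component row_def)
  then show ?thesis by (simp add: closed_INT closed_halfspace_le)
qed

text \<open>The worst case will be computed on these measures alone: displaced samples that stay in the
  support set and whose mean displacement respects the radius.\<close>

lemma empirical_mem_ambiguity_set: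
  assumes nrm: "is_norm nrm" and M: "M \<ge> 1"
    and W: "\<And>l. l \<in> {1..M} \<Longrightarrow> y l \<in> polyhedral_set H h"
    and budget: "(\<Sum>l=1..M. nrm (what l - y l)) / real M \<le> eps"
  shows "empirical M y \<in> ambiguity_set nrm H h eps M what"
proof -
  have [measurable]: "polyhedral_set H h \<in> sets borel"
    by (simp add: borel_closed closed_polyhedral_set)
  interpret prob_space "empirical M y" by (rule prob_space_empirical[OF M])
  have "AE w in empirical M y. w \<in> polyhedral_set H h"
    unfolding empirical_def
    by (subst AE_distr_iff) (use W in \<open>auto simp: space_uniform_count_measure intro!: AE_I2\<close>)
  then have "emeasure (empirical M y) (polyhedral_set H h) = 1"
    by (intro emeasure_eq_1_AE) (auto simp: empirical_def)
  moreover have "integrable (empirical M y) nrm"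
    by (intro empirical_integral borel_measurable_continuous_onI is_norm_continuous_on[OF nrm])
  moreover have "wasserstein nrm (empirical M what) (empirical M y) \<le> ennreal eps"
    using order_trans[OF wasserstein_empirical_le[OF nrm M] ennreal_leI[OF budget]] .
  ultimately show ?thesis
    using prob_space_axioms by (simp add: ambiguity_set_def prob_measures_on_def empirical_def)
qed

text \<open>The easy half of Kantorovich duality: the pointwise inequality between \<open>\<phi>\<close>, \<open>g\<close> and the transport
  cost is integrated against couplings whose cost exceeds \<open>eps\<close> by arbitrarily little; they exist
  because the distance is an infimum over couplings.\<close>

lemma wasserstein_weak_duality:
  fixes nrm :: "'a::euclidean_space \<Rightarrow> real" and \<phi> g :: "'a \<Rightarrow> real"
  assumes nrm: "is_norm nrm" and "0 \<le> L" and "0 \<le> eps"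
    and D: "prob_space D" "sets D = sets borel" "emeasure D W = 1"
    and near: "wasserstein nrm D0 D \<le> ennreal eps"
    and \<phi>: "integrable D \<phi>" and g: "integrable D0 g" and D0: "sets D0 = sets borel"
    and le: "\<And>\<xi> w. w \<in> W \<Longrightarrow> \<phi> w \<le> g \<xi> + L * nrm (\<xi> - w)"
  shows "(\<integral>w. \<phi> w \<partial>D) \<le> (\<integral>\<xi>. g \<xi> \<partial>D0) + L * eps"
proof -
  have approx: "(\<integral>w. \<phi> w \<partial>D) \<le> (\<integral>\<xi>. g \<xi> \<partial>D0) + L * (eps + d)" if "d > 0" for d
  proof -
    have "ennreal eps < ennreal (eps + d)" using \<open>0 \<le> eps\<close> that by (simp add: ennreal_lessI)
    then have "wasserstein nrm D0 D < ennreal (eps + d)" using near by (rule le_less_trans[rotated])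
    then obtain C where C: "C \<in> couplings D0 D"
      and cost: "(\<integral>\<^sup>+(\<xi>1, \<xi>2). ennreal (nrm (\<xi>1 - \<xi>2)) \<partial>C) < ennreal (eps + d)"
      unfolding wasserstein_def by (auto simp: INF_less_iff)
    from C have [measurable_cong]: "sets C = sets (borel \<Otimes>\<^sub>M borel)"
      and marg: "distr C borel fst = D0" "distr C borel snd = D"
      by (auto simp: couplings_def)
    have [measurable]: "nrm \<in> borel_measurable borel"
      by (intro borel_measurable_continuous_onI is_norm_continuous_on[OF nrm])
    have [measurable]: "\<phi> \<in> borel_measurable borel" "g \<in> borel_measurable borel"
      using borel_measurable_integrable[OF \<phi>] borel_measurable_integrable[OF g] D(2) D0
      by (simp_all cong: measurable_cong_sets)
    let ?c = "\<lambda>q. nrm (fst q - snd q)"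
    have cost': "(\<integral>\<^sup>+q. ennreal (?c q) \<partial>C) < ennreal (eps + d)"
      using cost by (simp add: case_prod_beta')
    have c_int: "integrable C ?c"
      using cost' is_norm_nonneg[OF nrm]
      by (intro integrableI_nonneg) (auto intro: order.strict_trans simp: top_unique less_top)
    have c_le: "(\<integral>q. ?c q \<partial>C) \<le> eps + d"
    proof -
      have "ennreal (\<integral>q. ?c q \<partial>C) < ennreal (eps + d)"
        using cost' nn_integral_eq_integral[OF c_int] is_norm_nonneg[OF nrm] by simp
      then show ?thesis using \<open>0 \<le> eps\<close> that by (meson ennreal_leI leI less_le not_less)
    qed
    have \<phi>_int: "integrable C (\<lambda>q. \<phi> (snd q))"
      using \<phi> unfolding marg(2)[symmetric] by (subst (asm) integrable_distr_eq) auto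
    have g_int: "integrable C (\<lambda>q. g (fst q))"
      using g unfolding marg(1)[symmetric] by (subst (asm) integrable_distr_eq) auto
    interpret D: prob_space D by (rule D(1))
    have "AE w in D. w \<in> W"
      using D(3) by (intro D.AE_prob_1) (simp add: D.emeasure_eq_measure)
    then have "AE q in C. snd q \<in> W"
      unfolding marg(2)[symmetric] by (rule AE_distrD[rotated]) simp
    then have "AE q in C. \<phi> (snd q) \<le> g (fst q) + L * ?c q"
      by eventually_elim (rule le)
    then have "(\<integral>q. \<phi> (snd q) \<partial>C) \<le> (\<integral>q. g (fst q) + L * ?c q \<partial>C)"
      by (intro integral_mono_AE \<phi>_int Bochner_Integration.integrable_add g_int
          integrable_mult_right c_int)
    also have "\<dots> = (\<integral>q. g (fst q) \<partial>C) + L * (\<integral>q. ?c q \<partial>C)"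
      using g_int c_int by simp
    also have "(\<integral>q. g (fst q) \<partial>C) = (\<integral>\<xi>. g \<xi> \<partial>D0)"
      unfolding marg(1)[symmetric] by (subst integral_distr) auto
    also have "(\<integral>q. \<phi> (snd q) \<partial>C) = (\<integral>w. \<phi> w \<partial>D)"
      unfolding marg(2)[symmetric] by (subst integral_distr) auto
    finally show ?thesis
      using mult_left_mono[OF c_le \<open>0 \<le> L\<close>] by linarith
  qed
  show ?thesis
  proof (rule tendsto_lowerbound)
    show "((\<lambda>d. (\<integral>\<xi>. g \<xi> \<partial>D0) + L * (eps + d)) \<longlongrightarrow> (\<integral>\<xi>. g \<xi> \<partial>D0) + L * eps) (at_right 0)"
      by (rule tendsto_eq_intros refl | simp)+
    show "\<forall>\<^sub>F d in at_right 0. (\<integral>w. \<phi> w \<partial>D) \<le> (\<integral>\<xi>. g \<xi> \<partial>D0) + L * (eps + d)"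
      using approx by (auto simp: eventually_at_right_field intro: gt_ex)
  qed simp
qed

text \<open>The function \<open>g \<xi> = (SUP w\<in>W. \<phi> w - L * nrm (\<xi> - w))\<close> is the smallest one admissible in weak
  duality. It is an upper envelope of functions with a common Lipschitz constant, so it is finite
  everywhere once it is finite at one point, and continuous, hence measurable even when \<open>W\<close> is
  uncountable. Repeated samples cause no difficulty: \<open>g\<close> takes a single value at each point, which
  lies below all of the bounds \<open>s\<close> attached to that point.\<close>

lemma continuous_c_transform:
  fixes nrm :: "'a::euclidean_space \<Rightarrow> real" and \<phi> :: "'a \<Rightarrow> real"
  assumes nrm: "is_norm nrm" and L: "0 \<le> L" and W: "W \<noteq> {}"
    and bound: "\<And>w. w \<in> W \<Longrightarrow> \<phi> w - L * nrm (\<xi>0 - w) \<le> s0"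
  obtains g where "continuous_on UNIV g"
    and "\<And>\<xi> w. w \<in> W \<Longrightarrow> \<phi> w \<le> g \<xi> + L * nrm (\<xi> - w)"
    and "\<And>\<xi> s. (\<And>w. w \<in> W \<Longrightarrow> \<phi> w - L * nrm (\<xi> - w) \<le> s) \<Longrightarrow> g \<xi> \<le> s"
proof -
  define g where "g \<xi> = (SUP w\<in>W. \<phi> w - L * nrm (\<xi> - w))" for \<xi>
  have shift: "\<phi> w - L * nrm (\<xi> - w) \<le> \<phi> w - L * nrm (\<xi>' - w) + L * nrm (\<xi> - \<xi>')" for \<xi> \<xi>' w
    using is_norm_triangle[OF nrm, of "\<xi>' - \<xi>" "\<xi> - w"] is_norm_minus[OF nrm, of "\<xi> - \<xi>'"] L
      mult_left_mono[of "nrm (\<xi>' - w)" "nrm (\<xi> - \<xi>') + nrm (\<xi> - w)" L]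
    by (simp add: algebra_simps)
  have bdd: "bdd_above ((\<lambda>w. \<phi> w - L * nrm (\<xi> - w)) ` W)" for \<xi>
  proof (rule bdd_aboveI2)
    fix w assume "w \<in> W"
    then show "\<phi> w - L * nrm (\<xi> - w) \<le> s0 + L * nrm (\<xi> - \<xi>0)"
      using shift[of w \<xi> \<xi>0] bound by fastforce
  qed
  have upper: "\<phi> w - L * nrm (\<xi> - w) \<le> g \<xi>" if "w \<in> W" for w \<xi>
    unfolding g_def by (rule cSUP_upper[OF that bdd])
  have least: "g \<xi> \<le> s" if "\<And>w. w \<in> W \<Longrightarrow> \<phi> w - L * nrm (\<xi> - w) \<le> s" for \<xi> s
    unfolding g_def using W that by (rule cSUP_least)
  have step: "g \<xi> \<le> g \<xi>' + L * nrm (\<xi> - \<xi>')" for \<xi> \<xi>'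
  proof (rule least)
    fix w assume "w \<in> W"
    then show "\<phi> w - L * nrm (\<xi> - w) \<le> g \<xi>' + L * nrm (\<xi> - \<xi>')"
      using shift[of w \<xi> \<xi>'] upper[of w \<xi>'] by linarith
  qed
  obtain C where C: "C > 0" "\<And>x. nrm x \<le> C * norm x"
    using is_norm_equivalent[OF nrm] by metis
  have "(L * C)-lipschitz_on UNIV g"
  proof (rule lipschitz_onI)
    fix \<xi> \<xi>' :: 'a
    have "\<bar>g \<xi> - g \<xi>'\<bar> \<le> L * nrm (\<xi> - \<xi>')"
      using step[of \<xi> \<xi>'] step[of \<xi>' \<xi>] is_norm_minus[OF nrm, of "\<xi> - \<xi>'"] by (simp add: abs_le_iff)
    also have "\<dots> \<le> L * (C * norm (\<xi> - \<xi>'))" using C L by (intro mult_left_mono) auto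
    finally show "dist (g \<xi>) (g \<xi>') \<le> L * C * dist \<xi> \<xi>'" by (simp add: dist_real_def dist_norm)
  qed (use C L in simp)
  then have "continuous_on UNIV g" by (rule lipschitz_on_continuous_on)
  moreover have "\<phi> w \<le> g \<xi> + L * nrm (\<xi> - w)" if "w \<in> W" for \<xi> w
    using upper[OF that, of \<xi>] by simp
  ultimately show thesis using least by (rule that)
qed

section \<open>One disturbance: the worst-case expectation over a Wasserstein ball\<close>

lemma ambiguity_set_integrable_linear:
  assumes nrm: "is_norm nrm" and D: "D \<in> ambiguity_set nrm H h eps M what"
  shows "integrable D (\<lambda>w. a \<bullet> w)"
proof -
  obtain c where c: "c > 0" "\<And>x. c * norm x \<le> nrm x"
    using is_norm_equivalent[OF nrm] by metis
  have int: "integrable D nrm" and sets: "sets D = sets borel"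
    using D by (auto simp: ambiguity_set_def prob_measures_on_def)
  have "integrable D (\<lambda>w. norm a / c * nrm w)" using int by simp
  then show ?thesis
  proof (rule Bochner_Integration.integrable_bound)
    show "AE w in D. norm (a \<bullet> w) \<le> norm (norm a / c * nrm w)"
    proof (rule AE_I2)
      fix w
      have "norm (a \<bullet> w) \<le> norm a * norm w" by (simp add: Cauchy_Schwarz_ineq2)
      also have "\<dots> \<le> norm a * (nrm w / c)"
        using c(1) c(2)[of w] by (intro mult_left_mono) (simp_all add: field_simps)
      finally show "norm (a \<bullet> w) \<le> norm (norm a / c * nrm w)"
        using c(1) is_norm_nonneg[OF nrm, of w] by simp
    qed
    have "(\<lambda>w. a \<bullet> w) \<in> borel_measurable borel"
      by (intro borel_measurable_continuous_onI continuous_intros)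
    then show "(\<lambda>w. a \<bullet> w) \<in> borel_measurable D"
      using measurable_cong_sets[OF sets refl] by blast
  qed
qed

text \<open>Soundness of a dual certificate: for \<open>w\<close> in the support set the slack \<open>h - H w\<close> is nonnegative, so
  each \<open>g l\<close> yields \<open>a \<bullet> w \<le> s l + L * nrm (what l - w)\<close>. The c-transform turns these
  inequalities, one for each sample, into a continuous function to which weak duality applies.\<close>

lemma worst_case_expectation_le_dual:
  fixes H :: "real^'x^'h"
  assumes nrm: "is_norm nrm" and eps: "eps > 0" and M: "M \<ge> 1"
    and samples: "\<And>l. l \<in> {1..M} \<Longrightarrow> what l \<in> polyhedral_set H h"
    and cert: "\<And>l. l \<in> {1..M} \<Longrightarrow>
      a \<bullet> what l + g l \<bullet> (h - H *v what l) \<le> s l \<and> dual_norm nrm (transpose H *v g l - a) \<le> L \<and> 0 \<le> g l"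
    and D: "D \<in> ambiguity_set nrm H h eps M what"
  shows "(\<integral>w. a \<bullet> w \<partial>D) \<le> L * eps + 1 / real M * (\<Sum>l=1..M. s l)"
proof -
  define W where "W = polyhedral_set H h"
  have one: "1 \<in> {1..M}" using M by simp
  have L: "0 \<le> L" using cert[OF one] by (simp add: dual_norm_le_iff[OF nrm])
  have pointwise: "a \<bullet> w - L * nrm (what l - w) \<le> s l" if l: "l \<in> {1..M}" and w: "w \<in> W" for l w
  proof -
    have "0 \<le> g l \<bullet> (h - H *v w)"
      using w cert[OF l] unfolding W_def polyhedral_set_def inner_vec_def
      by (intro sum_nonneg) (simp add: less_eq_vec_def)
    moreover have "(transpose H *v g l - a) \<bullet> (what l - w) \<le> L * nrm (what l - w)"
      using cert[OF l] dual_norm_le_iff[OF nrm] by blast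
    moreover have "(transpose H *v g l - a) \<bullet> (what l - w)
        = g l \<bullet> (H *v what l) - g l \<bullet> (H *v w) - a \<bullet> what l + a \<bullet> w"
      by (simp add: inner_diff_left inner_diff_right dot_lmul_matrix)
    ultimately show ?thesis using cert[OF l] by (simp add: inner_diff_right)
  qed
  have "W \<noteq> {}" using samples[OF one] by (auto simp: W_def)
  then obtain G where G: "continuous_on UNIV G"
    "\<And>\<xi> w. w \<in> W \<Longrightarrow> a \<bullet> w \<le> G \<xi> + L * nrm (\<xi> - w)"
    "\<And>\<xi> s. (\<And>w. w \<in> W \<Longrightarrow> a \<bullet> w - L * nrm (\<xi> - w) \<le> s) \<Longrightarrow> G \<xi> \<le> s"
    using continuous_c_transform[OF nrm L, of W "\<lambda>w. a \<bullet> w", OF _ pointwise[OF one]] by blast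
  have Gm: "G \<in> borel_measurable borel" by (rule borel_measurable_continuous_onI[OF G(1)])
  have "(\<integral>w. a \<bullet> w \<partial>D) \<le> (\<integral>\<xi>. G \<xi> \<partial>empirical M what) + L * eps"
  proof (rule wasserstein_weak_duality[OF nrm L _ _ _ _ _ ambiguity_set_integrable_linear[OF nrm D]
        empirical_integral(1)[OF Gm]])
    show "a \<bullet> w \<le> G \<xi> + L * nrm (\<xi> - w)" if "w \<in> W" for \<xi> w using that by (rule G(2))
  qed (use D eps in \<open>auto simp: ambiguity_set_def prob_measures_on_def W_def empirical_def\<close>)
  also have "(\<integral>\<xi>. G \<xi> \<partial>empirical M what) = (\<Sum>l=1..M. G (what l)) / real M"
    by (rule empirical_integral(2)[OF Gm])
  also have "\<dots> \<le> (\<Sum>l=1..M. s l) / real M"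
    by (intro divide_right_mono sum_mono G(3) pointwise) auto
  finally show ?thesis by simp
qed

text \<open>Completeness, with attained multipliers. Among displaced samples the worst case is a convex
  problem whose only coupling constraint is the transport budget. It has the Slater point \<open>y = what\<close>,
  which uses no budget while \<open>eps > 0\<close>. Its multiplier \<open>L\<close> decouples the samples, and for each of them
  the polyhedral duality, applied to the displacement from the sample, supplies the vector \<open>g l\<close>.\<close>

lemma dual_certificate_exists:
  fixes H :: "real^'x^'h" and what :: "nat \<Rightarrow> real^'x"
  assumes nrm: "is_norm nrm" and eps: "eps > 0" and M: "M \<ge> 1"
    and samples: "\<And>l. l \<in> {1..M} \<Longrightarrow> what l \<in> polyhedral_set H h"
    and bound: "\<And>D. D \<in> ambiguity_set nrm H h eps M what \<Longrightarrow> (\<integral>w. a \<bullet> w \<partial>D) \<le> p"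
  obtains L s g where "L * eps + 1 / real M * (\<Sum>l=1..M. s l) \<le> p"
    and "\<And>l. l \<in> {1..M} \<Longrightarrow>
      a \<bullet> what l + g l \<bullet> (h - H *v what l) \<le> s l \<and> dual_norm nrm (transpose H *v g l - a) \<le> L \<and> 0 \<le> g l"
proof -
  define W where "W = polyhedral_set H h"
  have M0: "real M > 0" using M by simp
  have convW: "convex W"
    unfolding W_def polyhedral_set_def
  proof (rule convexI, unfold mem_Collect_eq)
    fix x y and u v :: real assume *: "H *v x \<le> h" "H *v y \<le> h" "0 \<le> u" "0 \<le> v" "u + v = 1"
    then have "u * (H *v x) $ i + v * (H *v y) $ i \<le> h $ i" for i
      using convex_bound_le[of "(H *v x) $ i" "h $ i" "(H *v y) $ i" u v] by (simp add: less_eq_vec_def)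
    then show "H *v (u *\<^sub>R x + v *\<^sub>R y) \<le> h"
      by (simp add: less_eq_vec_def matrix_vector_right_distrib matrix_vector_mult_scaleR)
  qed
  \<comment> \<open>Budgets and mean values of displaced samples; with equality in place of the inequality
    for \<open>t\<close> the set need not be convex.\<close>
  define S where "S = {(t, v). \<exists>y. (\<forall>l\<in>{1..M}. y l \<in> W) \<and>
      (\<Sum>l=1..M. nrm (what l - y l)) / real M \<le> t \<and> v = (\<Sum>l=1..M. a \<bullet> y l) / real M}"
  have S_memI: "(t, v) \<in> S" if "\<And>l. l \<in> {1..M} \<Longrightarrow> y l \<in> W"
    "(\<Sum>l=1..M. nrm (what l - y l)) / real M \<le> t" "v = (\<Sum>l=1..M. a \<bullet> y l) / real M" for t v y
    unfolding S_def using that by blast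
  have "convex S"
  proof (rule convexI)
    fix q q' and c c' :: real assume "q \<in> S" "q' \<in> S" and c: "0 \<le> c" "0 \<le> c'" "c + c' = 1"
    then obtain t v y t' v' y' where q: "q = (t, v)" "\<And>l. l \<in> {1..M} \<Longrightarrow> y l \<in> W"
        "(\<Sum>l=1..M. nrm (what l - y l)) / real M \<le> t" "v = (\<Sum>l=1..M. a \<bullet> y l) / real M"
      and q': "q' = (t', v')" "\<And>l. l \<in> {1..M} \<Longrightarrow> y' l \<in> W"
        "(\<Sum>l=1..M. nrm (what l - y' l)) / real M \<le> t'" "v' = (\<Sum>l=1..M. a \<bullet> y' l) / real M"
      unfolding S_def by blast
    define y'' where "y'' l = c *\<^sub>R y l + c' *\<^sub>R y' l" for l
    have "y'' l \<in> W" if "l \<in> {1..M}" for l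
      unfolding y''_def using convexD[OF convW] q(2) q'(2) c that by blast
    moreover have "(\<Sum>l=1..M. nrm (what l - y'' l)) / real M \<le> c * t + c' * t'"
    proof -
      have "nrm (what l - y'' l) \<le> c * nrm (what l - y l) + c' * nrm (what l - y' l)" for l
      proof -
        have "what l - y'' l = (c + c') *\<^sub>R what l - y'' l" by (simp add: c(3))
        also have "\<dots> = c *\<^sub>R (what l - y l) + c' *\<^sub>R (what l - y' l)"
          by (simp add: y''_def algebra_simps)
        finally show ?thesis
          using is_norm_triangle[OF nrm, of "c *\<^sub>R (what l - y l)" "c' *\<^sub>R (what l - y' l)"] c
          by (simp add: is_norm_scaleR[OF nrm])
      qed
      then have "(\<Sum>l=1..M. nrm (what l - y'' l)) / real M
          \<le> (\<Sum>l=1..M. c * nrm (what l - y l) + c' * nrm (what l - y' l)) / real M"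
        by (intro divide_right_mono sum_mono) auto
      also have "\<dots> = c * ((\<Sum>l=1..M. nrm (what l - y l)) / real M)
          + c' * ((\<Sum>l=1..M. nrm (what l - y' l)) / real M)"
        by (simp add: sum.distrib sum_distrib_left add_divide_distrib)
      also have "\<dots> \<le> c * t + c' * t'"
        using q(3) q'(3) c by (intro add_mono mult_left_mono)
      finally show ?thesis .
    qed
    moreover have "c * v + c' * v' = (\<Sum>l=1..M. a \<bullet> y'' l) / real M"
      by (simp add: q(4) q'(4) y''_def inner_add_right sum.distrib sum_distrib_left add_divide_distrib)
    ultimately have "(c * t + c' * t', c * v + c' * v') \<in> S" by (rule S_memI)
    then show "c *\<^sub>R q + c' *\<^sub>R q' \<in> S" by (simp add: q(1) q'(1))
  qed
  moreover have "(t', v) \<in> S" if "(t, v) \<in> S" "t \<le> t'" for t v t'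
    using that unfolding S_def by force
  moreover have "(0, (\<Sum>l=1..M. a \<bullet> what l) / real M) \<in> S"
    by (rule S_memI[of what]) (simp_all add: samples W_def is_norm_zero[OF nrm])
  moreover have "v \<le> p" if eS: "(eps, v) \<in> S" for v
  proof -
    from eS obtain y where y: "\<And>l. l \<in> {1..M} \<Longrightarrow> y l \<in> W"
      "(\<Sum>l=1..M. nrm (what l - y l)) / real M \<le> eps" "v = (\<Sum>l=1..M. a \<bullet> y l) / real M"
      unfolding S_def by blast
    have "empirical M y \<in> ambiguity_set nrm H h eps M what"
      by (rule empirical_mem_ambiguity_set[OF nrm M _ y(2)]) (use y(1) in \<open>simp add: W_def\<close>)
    from bound[OF this] show ?thesis
      by (subst (asm) empirical_integral(2)) (simp_all add: y(3))
  qed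
  ultimately obtain L where L: "0 \<le> L" "\<And>t v. (t, v) \<in> S \<Longrightarrow> v - L * (t - eps) \<le> p"
    using scalar_Lagrange_multiplier[of S 0 _ eps p, OF _ _ _ eps] by blast
  obtain s where s: "\<And>l y. l \<in> {1..M} \<Longrightarrow> y \<in> (\<lambda>w. a \<bullet> w - L * nrm (what l - w)) ` W \<Longrightarrow> y \<le> s l"
    "(\<Sum>l=1..M. s l) \<le> real M * (p - L * eps)"
  proof (rule separate_upper_bounds[of "{1..M}" "\<lambda>l. (\<lambda>w. a \<bullet> w - L * nrm (what l - w)) ` W"])
    show "(\<lambda>w. a \<bullet> w - L * nrm (what l - w)) ` W \<noteq> {}" if "l \<in> {1..M}" for l
      using samples that by (auto simp: W_def)
    fix x assume "\<And>l. l \<in> {1..M} \<Longrightarrow> x l \<in> (\<lambda>w. a \<bullet> w - L * nrm (what l - w)) ` W"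
    then have "\<forall>l\<in>{1..M}. \<exists>w. w \<in> W \<and> x l = a \<bullet> w - L * nrm (what l - w)" by blast
    then obtain y where y: "\<And>l. l \<in> {1..M} \<Longrightarrow> y l \<in> W \<and> x l = a \<bullet> y l - L * nrm (what l - y l)"
      by metis
    have "((\<Sum>l=1..M. nrm (what l - y l)) / real M, (\<Sum>l=1..M. a \<bullet> y l) / real M) \<in> S"
      by (rule S_memI[OF _ order_refl refl]) (simp add: y)
    from L(2)[OF this] have "(\<Sum>l=1..M. a \<bullet> y l) - L * (\<Sum>l=1..M. nrm (what l - y l)) \<le> real M * (p - L * eps)"
      using M0 by (simp add: field_simps)
    also have "(\<Sum>l=1..M. a \<bullet> y l) - L * (\<Sum>l=1..M. nrm (what l - y l)) = (\<Sum>l=1..M. x l)"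
      unfolding sum_distrib_left sum_subtractf[symmetric] using y by (intro sum.cong) auto
    finally show "(\<Sum>l=1..M. x l) \<le> real M * (p - L * eps)" .
  qed auto
  have "\<exists>g. a \<bullet> what l + g \<bullet> (h - H *v what l) \<le> s l \<and> dual_norm nrm (transpose H *v g - a) \<le> L \<and> 0 \<le> g"
    if l: "l \<in> {1..M}" for l
  proof -
    have slack: "0 \<le> h - H *v what l"
      using samples[OF l] by (simp add: polyhedral_set_def)
    have "a \<bullet> x - L * nrm x \<le> s l - a \<bullet> what l" if "H *v x \<le> h - H *v what l" for x
    proof -
      have "what l + x \<in> W"
        using that by (simp add: W_def polyhedral_set_def matrix_vector_right_distrib le_diff_eq add.commute)
      then show ?thesis
        using s(1)[OF l imageI, of "what l + x"]
        by (simp add: inner_add_right is_norm_minus[OF nrm])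
    qed
    then obtain g where "0 \<le> g" "g \<bullet> (h - H *v what l) \<le> s l - a \<bullet> what l"
        "dual_norm nrm (transpose H *v g - a) \<le> L"
      using norm_penalised_polyhedral_duality[OF nrm slack L(1)] by blast
    then show ?thesis by (intro exI[of _ g]) simp
  qed
  then have "\<forall>l\<in>{1..M}. \<exists>g. a \<bullet> what l + g \<bullet> (h - H *v what l) \<le> s l
      \<and> dual_norm nrm (transpose H *v g - a) \<le> L \<and> 0 \<le> g" by blast
  from bchoice[OF this] obtain g where "\<And>l. l \<in> {1..M} \<Longrightarrow>
      a \<bullet> what l + g l \<bullet> (h - H *v what l) \<le> s l \<and> dual_norm nrm (transpose H *v g l - a) \<le> L \<and> 0 \<le> g l"
    by blast
  moreover have "L * eps + 1 / real M * (\<Sum>l=1..M. s l) \<le> p"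
    using s(2) M0 by (simp add: field_simps)
  ultimately show thesis using that by blast
qed

section \<open>Independent disturbances and the reformulation\<close>

text \<open>Only the marginals of a product measure matter for a function that is a sum over the
  coordinates.\<close>

lemma integral_sum_PiM:
  fixes \<phi> :: "'i \<Rightarrow> 'a \<Rightarrow> real"
  assumes P: "\<And>m. m \<in> I \<Longrightarrow> prob_space (P m)"
    and int: "\<And>m. m \<in> I \<Longrightarrow> integrable (P m) (\<phi> m)"
  shows "(\<integral>W. b + (\<Sum>m\<in>I. \<phi> m (W m)) \<partial>PiM I P) = b + (\<Sum>m\<in>I. \<integral>w. \<phi> m w \<partial>P m)"
proof -
  interpret prob_space "PiM I P" by (rule prob_space_PiM[OF P])
  have marg: "distr (PiM I P) (P m) (\<lambda>W. W m) = P m" if "m \<in> I" for m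
    by (rule distr_PiM_component[OF P that])
  have comp: "(\<lambda>W. W m) \<in> measurable (PiM I P) (P m)" if "m \<in> I" for m
    using that by (rule measurable_component_singleton)
  have intm: "integrable (PiM I P) (\<lambda>W. \<phi> m (W m))" if "m \<in> I" for m
    using integrable_distr[OF comp[OF that]] int[OF that] marg[OF that] by metis
  have "(\<integral>W. \<phi> m (W m) \<partial>PiM I P) = (\<integral>w. \<phi> m w \<partial>P m)" if m: "m \<in> I" for m
    using integral_distr[OF comp[OF m] borel_measurable_integrable[OF int[OF m]]] marg[OF m]
    by simp
  then have "(\<Sum>m\<in>I. \<integral>W. \<phi> m (W m) \<partial>PiM I P) = (\<Sum>m\<in>I. \<integral>w. \<phi> m w \<partial>P m)"
    by (intro sum.cong) auto
  then show ?thesis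
    using intm by (simp add: Bochner_Integration.integral_add Bochner_Integration.integral_sum prob_space)
qed

text \<open>The supremum over products of measures separates into a sum of worst cases, one for each
  disturbance, because the integrand is affine and the measures are chosen independently. Each worst
  case is then exchanged for a certificate.\<close>

lemma robust_constraint_iff:
  fixes H :: "real^'x^'h" and what :: "nat \<Rightarrow> real^'x" and a :: "nat \<Rightarrow> real^'x"
  assumes nrm: "is_norm nrm" and eps: "eps > 0" and M: "M \<ge> 1"
    and samples: "\<And>l. l \<in> {1..M} \<Longrightarrow> what l \<in> polyhedral_set H h"
  shows "(SUP P\<in>{..<i} \<rightarrow>\<^sub>E ambiguity_set nrm H h eps M what.
            ereal (\<integral>W. b + (\<Sum>m<i. a m \<bullet> W m) \<partial>PiM {..<i} P)) \<le> ereal c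
    \<longleftrightarrow> (\<exists>L s g. (\<Sum>m<i. L m * eps + 1 / real M * (\<Sum>l=1..M. s m l)) \<le> c - b \<and>
          (\<forall>m<i. \<forall>l\<in>{1..M}. a m \<bullet> what l + g m l \<bullet> (h - H *v what l) \<le> s m l \<and>
             dual_norm nrm (transpose H *v g m l - a m) \<le> L m \<and> 0 \<le> g m l))"
    (is "?sup \<longleftrightarrow> (\<exists>L s g. ?budget L s \<and> ?cert L s g)")
proof -
  define Amb where "Amb = ambiguity_set nrm H h eps M what"
  have expectation: "(\<integral>W. b + (\<Sum>m<i. a m \<bullet> W m) \<partial>PiM {..<i} P) = b + (\<Sum>m<i. \<integral>w. a m \<bullet> w \<partial>P m)"
    if "\<And>m. m < i \<Longrightarrow> P m \<in> Amb" for P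
  proof (rule integral_sum_PiM)
    fix m assume "m \<in> {..<i}"
    then have "P m \<in> ambiguity_set nrm H h eps M what" using that by (simp add: Amb_def)
    then show "prob_space (P m)" "integrable (P m) (\<lambda>w. a m \<bullet> w)"
      using ambiguity_set_integrable_linear[OF nrm]
      by (simp add: ambiguity_set_def prob_measures_on_def, blast)
  qed
  have sup: "?sup \<longleftrightarrow> (\<forall>P\<in>{..<i} \<rightarrow>\<^sub>E Amb. (\<Sum>m<i. \<integral>w. a m \<bullet> w \<partial>P m) \<le> c - b)"
  proof -
    have "?sup \<longleftrightarrow> (\<forall>P\<in>{..<i} \<rightarrow>\<^sub>E Amb. (\<integral>W. b + (\<Sum>m<i. a m \<bullet> W m) \<partial>PiM {..<i} P) \<le> c)"
      by (simp add: SUP_le_iff Amb_def)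
    also have "\<dots> \<longleftrightarrow> (\<forall>P\<in>{..<i} \<rightarrow>\<^sub>E Amb. (\<Sum>m<i. \<integral>w. a m \<bullet> w \<partial>P m) \<le> c - b)"
    proof (rule ball_cong[OF refl])
      fix P assume "P \<in> {..<i} \<rightarrow>\<^sub>E Amb"
      then have "(\<integral>W. b + (\<Sum>m<i. a m \<bullet> W m) \<partial>PiM {..<i} P) = b + (\<Sum>m<i. \<integral>w. a m \<bullet> w \<partial>P m)"
        by (intro expectation) auto
      then show "((\<integral>W. b + (\<Sum>m<i. a m \<bullet> W m) \<partial>PiM {..<i} P) \<le> c)
          \<longleftrightarrow> ((\<Sum>m<i. \<integral>w. a m \<bullet> w \<partial>P m) \<le> c - b)" by linarith
    qed
    finally show ?thesis .
  qed
  show ?thesis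
  proof
    assume ?sup
    with sup have le: "(\<Sum>m<i. \<integral>w. a m \<bullet> w \<partial>P m) \<le> c - b" if "P \<in> {..<i} \<rightarrow>\<^sub>E Amb" for P
      using that by blast
    have "empirical M what \<in> Amb"
      unfolding Amb_def
      by (rule empirical_mem_ambiguity_set[OF nrm M samples])
        (use eps in \<open>auto simp: is_norm_zero[OF nrm]\<close>)
    then have ne: "Amb \<noteq> {}" by blast
    obtain p where p: "\<And>m y. m \<in> {..<i} \<Longrightarrow> y \<in> (\<lambda>D. \<integral>w. a m \<bullet> w \<partial>D) ` Amb \<Longrightarrow> y \<le> p m"
      "(\<Sum>m<i. p m) \<le> c - b"
    proof (rule separate_upper_bounds[of "{..<i}" "\<lambda>m. (\<lambda>D. \<integral>w. a m \<bullet> w \<partial>D) ` Amb" "c - b"])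
      fix x assume "\<And>m. m \<in> {..<i} \<Longrightarrow> x m \<in> (\<lambda>D. \<integral>w. a m \<bullet> w \<partial>D) ` Amb"
      then have "\<forall>m\<in>{..<i}. \<exists>D. D \<in> Amb \<and> x m = (\<integral>w. a m \<bullet> w \<partial>D)" by blast
      from bchoice[OF this] obtain P
        where P: "\<And>m. m < i \<Longrightarrow> P m \<in> Amb \<and> x m = (\<integral>w. a m \<bullet> w \<partial>P m)" by blast
      \<comment> \<open>The family is indexed by an extensional product, so it must be undefined from \<open>i\<close> on.\<close>
      have "(\<Sum>m<i. x m) = (\<Sum>m<i. \<integral>w. a m \<bullet> w \<partial>restrict P {..<i} m)"
        using P by (intro sum.cong) auto
      also have "\<dots> \<le> c - b" by (rule le, subst restrict_PiE_iff) (use P in blast)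
      finally show "(\<Sum>m<i. x m) \<le> c - b" .
    qed (use ne in auto)
    define stage where "stage m L s g \<longleftrightarrow> L * eps + 1 / real M * (\<Sum>l=1..M. s l) \<le> p m \<and>
        (\<forall>l\<in>{1..M}. a m \<bullet> what l + g l \<bullet> (h - H *v what l) \<le> s l \<and>
          dual_norm nrm (transpose H *v g l - a m) \<le> L \<and> 0 \<le> g l)" for m L s g
    have "\<exists>L s g. stage m L s g" if m: "m < i" for m
    proof -
      have bound: "(\<integral>w. a m \<bullet> w \<partial>D) \<le> p m" if "D \<in> ambiguity_set nrm H h eps M what" for D
        using p(1)[of m] m that by (auto simp: Amb_def)
      show ?thesis
      proof (rule dual_certificate_exists[OF nrm eps M])
        show "what l \<in> polyhedral_set H h" if "l \<in> {1..M}" for l using that by (rule samples)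
        show "(\<integral>w. a m \<bullet> w \<partial>D) \<le> p m" if "D \<in> ambiguity_set nrm H h eps M what" for D
          using that by (rule bound)
      qed (unfold stage_def, blast)
    qed
    then obtain L s g where stage: "\<And>m. m < i \<Longrightarrow> stage m (L m) (s m) (g m)" by metis
    have "(\<Sum>m<i. L m * eps + 1 / real M * (\<Sum>l=1..M. s m l)) \<le> (\<Sum>m<i. p m)"
      using stage by (intro sum_mono) (simp add: stage_def)
    also note p(2)
    finally have "?budget L s" .
    moreover have "?cert L s g" using stage by (simp add: stage_def)
    ultimately show "\<exists>L s g. ?budget L s \<and> ?cert L s g" by blast
  next
    assume "\<exists>L s g. ?budget L s \<and> ?cert L s g"
    then obtain L s g where budget: "?budget L s" and cert: "?cert L s g" by blast
    have "(\<Sum>m<i. \<integral>w. a m \<bullet> w \<partial>P m) \<le> c - b" if P: "P \<in> {..<i} \<rightarrow>\<^sub>E Amb" for P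
    proof -
      have "(\<integral>w. a m \<bullet> w \<partial>P m) \<le> L m * eps + 1 / real M * (\<Sum>l=1..M. s m l)" if m: "m < i" for m
      proof (rule worst_case_expectation_le_dual[OF nrm eps M])
        show "what l \<in> polyhedral_set H h" if "l \<in> {1..M}" for l using that by (rule samples)
        show "a m \<bullet> what l + g m l \<bullet> (h - H *v what l) \<le> s m l \<and>
            dual_norm nrm (transpose H *v g m l - a m) \<le> L m \<and> 0 \<le> g m l" if "l \<in> {1..M}" for l
          using cert m that by blast
        show "P m \<in> ambiguity_set nrm H h eps M what" using P m by (auto simp: Amb_def)
      qed
      then have "(\<Sum>m<i. \<integral>w. a m \<bullet> w \<partial>P m)
          \<le> (\<Sum>m<i. L m * eps + 1 / real M * (\<Sum>l=1..M. s m l))"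
        by (intro sum_mono) (simp only: lessThan_iff)
      with budget show ?thesis by (rule order_trans[rotated])
    qed
    with sup show ?sup by blast
  qed
qed

theorem proposition1:
  fixes fd :: "(real^'x) \<times> (real^'u) \<Rightarrow> real^'x"
    and Q Qf :: "real^'x^'x" and R :: "real^'u^'u"
    and F :: "real^'x^'f" and f :: "real^'f"
    and nrm :: "real^'x \<Rightarrow> real"
    and H :: "real^'x^'h" and h :: "real^'h"
    and eps :: real
    and M N :: nat
    and what :: "nat \<Rightarrow> real^'x"
    and xk :: "real^'x"
  assumes "fd differentiable_on UNIV"
    and "positive_definite Q" and "positive_definite R" and "positive_definite Qf"
    and "is_norm nrm"
    and "eps > 0"
    and "M \<ge> 1"
    and "N \<ge> 1"
    and "\<And>l. l \<in> {1..M} \<Longrightarrow> what l \<in> polyhedral_set H h"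
  shows "(\<forall>z v K.
            feasible_P fd F f (ambiguity_set nrm H h eps M what) N xk z v K \<longleftrightarrow>
            (\<exists>lam s gam. feasible_P' fd F f nrm H h eps M what N xk z v K lam s gam)) \<and>
         (INF (z, v, K)\<in>{(z, v, K).
              feasible_P fd F f (ambiguity_set nrm H h eps M what) N xk z v K}.
            ereal (cost Q R Qf N z v)) =
         (INF (z, v, K, lam, s, gam)\<in>{(z, v, K, lam, s, gam).
              feasible_P' fd F f nrm H h eps M what N xk z v K lam s gam}.
            ereal (cost Q R Qf N z v))"
proof (rule conjI)
  show iff: "\<forall>z v K.
            feasible_P fd F f (ambiguity_set nrm H h eps M what) N xk z v K \<longleftrightarrow>
            (\<exists>lam s gam. feasible_P' fd F f nrm H h eps M what N xk z v K lam s gam)"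
  proof (intro allI)
    fix z v K
    define a where "a i n m = row n F v* A_cl_prod fd z v K i m" for i n m
    define dual where "dual i n L s g \<longleftrightarrow>
        (\<Sum>m<i. L m * eps + 1 / real M * (\<Sum>l=1..M. s m l)) \<le> f $ n - row n F \<bullet> z i \<and>
        (\<forall>m<i. \<forall>l\<in>{1..M}. a i n m \<bullet> what l + g m l \<bullet> (h - H *v what l) \<le> s m l \<and>
           dual_norm nrm (transpose H *v g m l - a i n m) \<le> L m \<and> 0 \<le> g m l)"
      for i n L s g
    have linear: "row n F \<bullet> (z i + (\<Sum>m<i. A_cl_prod fd z v K i m *v W m))
        = row n F \<bullet> z i + (\<Sum>m<i. a i n m \<bullet> W m)" for n i W
      by (simp add: a_def inner_add_right inner_sum_right dot_lmul_matrix)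
    have "feasible_P fd F f (ambiguity_set nrm H h eps M what) N xk z v K \<longleftrightarrow>
        nominal_constraints fd N xk z v K \<and> (\<forall>i\<in>{1..N}. \<forall>n. \<exists>L s g. dual i n L s g)"
      unfolding feasible_P_def linear dual_def
      by (subst robust_constraint_iff[OF assms(5,6,7)]) (rule assms(9) refl, assumption?)+
    also have "(\<forall>i\<in>{1..N}. \<forall>n. \<exists>L s g. dual i n L s g) \<longleftrightarrow>
        (\<exists>lam s gam. \<forall>i\<in>{1..N}. \<forall>n. dual i n (lam i n) (s i n) (gam i n))"
      by metis
    also have "nominal_constraints fd N xk z v K \<and>
        (\<exists>lam s gam. \<forall>i\<in>{1..N}. \<forall>n. dual i n (lam i n) (s i n) (gam i n)) \<longleftrightarrow>
        (\<exists>lam s gam. feasible_P' fd F f nrm H h eps M what N xk z v K lam s gam)"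
      unfolding feasible_P'_def dual_def a_def by simp
    finally show "feasible_P fd F f (ambiguity_set nrm H h eps M what) N xk z v K \<longleftrightarrow>
        (\<exists>lam s gam. feasible_P' fd F f nrm H h eps M what N xk z v K lam s gam)" .
  qed
  show "(INF (z, v, K)\<in>{(z, v, K).
              feasible_P fd F f (ambiguity_set nrm H h eps M what) N xk z v K}.
            ereal (cost Q R Qf N z v)) =
         (INF (z, v, K, lam, s, gam)\<in>{(z, v, K, lam, s, gam).
              feasible_P' fd F f nrm H h eps M what N xk z v K lam s gam}.
            ereal (cost Q R Qf N z v))"
  proof (rule INF_eq)
    fix q assume "q \<in> {(z, v, K). feasible_P fd F f (ambiguity_set nrm H h eps M what) N xk z v K}"
    then obtain z v K where q: "q = (z, v, K)"
      and "feasible_P fd F f (ambiguity_set nrm H h eps M what) N xk z v K" by blast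
    with iff obtain lam s gam
      where "feasible_P' fd F f nrm H h eps M what N xk z v K lam s gam" by blast
    then show "\<exists>r\<in>{(z, v, K, lam, s, gam). feasible_P' fd F f nrm H h eps M what N xk z v K lam s gam}.
        (case r of (z, v, K, lam, s, gam) \<Rightarrow> ereal (cost Q R Qf N z v))
          \<le> (case q of (z, v, K) \<Rightarrow> ereal (cost Q R Qf N z v))"
      by (intro bexI[of _ "(z, v, K, lam, s, gam)"]) (simp_all add: q)
  next
    fix r assume "r \<in> {(z, v, K, lam, s, gam). feasible_P' fd F f nrm H h eps M what N xk z v K lam s gam}"
    then obtain z v K lam s gam where r: "r = (z, v, K, lam, s, gam)"
      and "feasible_P' fd F f nrm H h eps M what N xk z v K lam s gam" by blast
    with iff have "feasible_P fd F f (ambiguity_set nrm H h eps M what) N xk z v K" by blast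
    then show "\<exists>q\<in>{(z, v, K). feasible_P fd F f (ambiguity_set nrm H h eps M what) N xk z v K}.
        (case q of (z, v, K) \<Rightarrow> ereal (cost Q R Qf N z v))
          \<le> (case r of (z, v, K, lam, s, gam) \<Rightarrow> ereal (cost Q R Qf N z v))"
      by (intro bexI[of _ "(z, v, K)"]) (simp_all add: r)
  qed
qed

end
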